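(* Let $L, m, n, N$ be positive integers with $m>1$. Let $P=[\vec P_{00}\ \vec P_{01}\ \cdots\ \vec P_{0(n-1)}]$ be a $1\times n$ exponent matrix of a $1$-level Type-$L$ CPM-QC-LDPC code $\mathcal{C}$ with lifting degree $N$, girth $\mathbf{g}$ and minimum distance $d_{\mathbf{min}}$. Let $P^*$ be an $m\times n$ exponent matrix such that, for each $j\in\{0,1,\dots,n-1\}$, the $j$-th column of $P^*$ is an $m$-column dispersion of $\vec P_{0j}$. Then $P^*$, with lifting degree $N$, is an exponent matrix of an $m$-level Type-$L^*$ CPM-QC-LDPC code $\mathcal{C}^*$ for some integer $L^*$ with $1\le L^*\le L$, and the girth $\mathbf{g}^*$ and minimum distance $d^*_{\mathbf{min}}$ of $\mathcal{C}^*$ satisfy $\mathbf{g}^*\ge \mathbf{g}$ and $d^*_{\mathbf{min}}\ge d_{\mathbf{min}}$.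
   Context: Exponent matrices and codes. Fix a positive integer $N$ (the lifting degree). For $p\in\{0,1,\dots,N-1\}$ let $I^{p}$ be the $N\times N$ circulant permutation matrix (CPM) whose rows are those of the identity matrix cyclically shifted to the right by $p$ positions (so the entry in row $a$ and column $b$, indexed modulo $N$, is $1$ if $b\equiv a+p \pmod N$ and $0$ otherwise). An $m\times n$ exponent matrix $P=[\vec P_{ij}]$, $0\le i\le m-1$, $0\le j\le n-1$, has as each entry either a vector $\vec P_{ij}=(p^1_{ij},\dots,p^l_{ij})$, $l\ge 1$ (with $l$ depending on $i,j$), of pairwise distinct elements of $\{0,1,\dots,N-1\}$, or the symbol $(-\infty)$. It determines the $mN\times nN$ binary parity-check matrix $H=[H_{ij}]$ made of $N\times N$ blocks, where $H_{ij}=I^{p^1_{ij}}+\cdots+I^{p^l_{ij}}$ in the first case and $H_{ij}=0$ in the second. The associated binary linear code $\mathcal{C}=\{x\in\mathbb{F}_2^{nN}: Hx^{T}=0\}$ is called an $m$-level Type-$L$ CPM-QC-LDPC code of lifting degree $N$, where $L$ is the maximum over all $i,j$ of the number $l$ of CPMs that constitute $H_{ij}$ (a zero block counts as $0$, and $L\ge 1$, i.e. at least one block is nonzero). Girth and minimum distance. The Tanner graph of $\mathcal{C}$ (taken with respect to $H$) is the bipartite graph with bi-adjacency matrix $H$: one vertex per row, one vertex per column, and an edge between a row and a column exactly when the corresponding entry of $H$ is $1$. The girth of $\mathcal{C}$ is the length of a shortest cycle in this Tanner graph ($+\infty$ if there is no cycle). The minimum distance of $\mathcal{C}$ is the minimum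 Hamming weight of its nonzero codewords ($+\infty$ if $\mathcal{C}=\{0\}$). Column dispersion. Let $m>1$ and let $\vec P_{ij}=(p^1_{ij},\dots,p^l_{ij})$ be an entry of an exponent matrix. An $m$-column dispersion of $\vec P_{ij}$ is a column of $m$ entries obtained by distributing the elements $p^1_{ij},\dots,p^l_{ij}$ into $m$ smaller vectors $\vec P^1_{ij},\dots,\vec P^m_{ij}$, so that each element lies in exactly one of them, and placing these from top to bottom in a column. Some of the parts may be empty, and an empty part is written as $(-\infty)$. The $m$-column dispersion of $(-\infty)$ is the column all of whose $m$ entries are $(-\infty)$. For example, $\big((0),(3,11),(-\infty),(17),(4)\big)^{T}$ is a $5$-column dispersion of $(0,3,4,11,17)$. *)

theory Defs
  imports
    "Jordan_Normal_Form.Matrix_Kernel"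
    "HOL-Library.Z2"
    "HOL-Library.Extended_Nat"
    "HOL-Number_Theory.Cong"
begin

text \<open>
  An entry of an exponent matrix is a list of exponents. The empty list encodes the symbol
  \<open>(-\<infinity>)\<close>; nonempty lists are the vectors of length \<open>l \<ge> 1\<close>.
\<close>

type_synonym exp_entry = "nat list"

definition valid_entry :: "nat \<Rightarrow> exp_entry \<Rightarrow> bool" where
  "valid_entry N v \<longleftrightarrow> distinct v \<and> set v \<subseteq> {0..<N}"

definition exponent_matrix :: "nat \<Rightarrow> nat \<Rightarrow> nat \<Rightarrow> exp_entry mat \<Rightarrow> bool" where
  "exponent_matrix N m n P \<longleftrightarrow>
     0 < N \<and> 0 < m \<and> 0 < n \<and> P \<in> carrier_mat m n \<and>
     (\<forall>i<m. \<forall>j<n. valid_entry N (P $$ (i, j)))"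

text \<open>
  \<open>type_exponent_matrix N m n L P\<close>: with lifting degree \<open>N\<close>, the \<open>m \<times> n\<close> matrix \<open>P\<close> is an
  exponent matrix of an \<open>m\<close>-level Type-\<open>L\<close> CPM-QC-LDPC code.
\<close>

definition type_exponent_matrix ::
    "nat \<Rightarrow> nat \<Rightarrow> nat \<Rightarrow> nat \<Rightarrow> exp_entry mat \<Rightarrow> bool" where
  "type_exponent_matrix N m n L P \<longleftrightarrow>
     exponent_matrix N m n P \<and> 1 \<le> L \<and>
     L = Max {length (P $$ (i, j)) | i j. i < m \<and> j < n}"

definition cpm :: "nat \<Rightarrow> nat \<Rightarrow> bit mat" where
  "cpm N p = mat N N (\<lambda>(a, b). if [b = a + p] (mod N) then 1 else 0)"

definition block :: "nat \<Rightarrow> exp_entry \<Rightarrow> bit mat" where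
  "block N v = foldr (+) (map (cpm N) v) (0\<^sub>m N N)"

definition parity_check :: "nat \<Rightarrow> exp_entry mat \<Rightarrow> bit mat" where
  "parity_check N P =
     mat (dim_row P * N) (dim_col P * N)
       (\<lambda>(r, c). block N (P $$ (r div N, c div N)) $$ (r mod N, c mod N))"

definition code :: "nat \<Rightarrow> exp_entry mat \<Rightarrow> bit vec set" where
  "code N P = mat_kernel (parity_check N P)"

definition hamming_weight :: "bit vec \<Rightarrow> nat" where
  "hamming_weight x = card {k. k < dim_vec x \<and> x $ k \<noteq> 0}"

text \<open>In \<^typ>\<open>enat\<close> the infimum of the empty set is \<open>\<infinity>\<close>.\<close>

definition min_distance :: "bit vec set \<Rightarrow> enat" where
  "min_distance C = (INF x \<in> {x \<in> C. x \<noteq> 0\<^sub>v (dim_vec x)}. enat (hamming_weight x))"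

text \<open>A simple undirected graph is a pair of its vertex set and its set of two-element edges.\<close>

type_synonym 'v ugraph = "'v set \<times> 'v set set"

definition is_cycle :: "'v ugraph \<Rightarrow> 'v list \<Rightarrow> bool" where
  "is_cycle G vs \<longleftrightarrow>
     3 \<le> length vs \<and> distinct vs \<and> set vs \<subseteq> fst G \<and>
     (\<forall>k<length vs. {vs ! k, vs ! (Suc k mod length vs)} \<in> snd G)"

definition girth :: "'v ugraph \<Rightarrow> enat" where
  "girth G = (INF vs \<in> {vs. is_cycle G vs}. enat (length vs))"

text \<open>Rows are the vertices \<open>Inl r\<close>, columns the vertices \<open>Inr c\<close>.\<close>

definition tanner_graph :: "bit mat \<Rightarrow> (nat + nat) ugraph" where
  "tanner_graph H =
     (Inl ` {0..<dim_row H} \<union> Inr ` {0..<dim_col H},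
      {{Inl r, Inr c} | r c. r < dim_row H \<and> c < dim_col H \<and> H $$ (r, c) = 1})"

text \<open>
  The parts \<open>w $ 0, \<dots>, w $ (m - 1)\<close> may list their elements in any order. For the empty list
  \<open>v\<close> all parts are forced to be empty.
\<close>

definition column_dispersion :: "nat \<Rightarrow> exp_entry \<Rightarrow> exp_entry vec \<Rightarrow> bool" where
  "column_dispersion m v w \<longleftrightarrow>
     w \<in> carrier_vec m \<and>
     (\<forall>i<m. distinct (w $ i) \<and> set (w $ i) \<subseteq> set v) \<and>
     (\<forall>p \<in> set v. \<exists>!i. i < m \<and> p \<in> set (w $ i))"

end

(*
  Merging the m block rows of the parity-check matrix H* of the dispersion gives back H: every block
  of H is the sum of the blocks in the corresponding block column of H*.  Hence each row of H is
  a sum of rows of H*, so ker H* is contained in ker H and the minimum distance cannot drop.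
  On Tanner graphs the merging r |-> r mod N is a homomorphism which is injective on
  neighbourhoods, because an exponent occurs in only one part of a dispersion.  Such a
  homomorphism sends a cycle to a closed non-backtracking walk, and a shortest return of that walk
  to a vertex is a cycle of at most the same length.
*)
theory Submission
  imports Defs
begin

section \<open>Cycles and locally injective graph homomorphisms\<close>

lemma girth_le_of_locally_injective_hom:
  fixes G :: "'a ugraph" and G' :: "'b ugraph"
  assumes vert: "f ` fst G \<subseteq> fst G'"
    and edge: "\<And>u v. {u, v} \<in> snd G \<Longrightarrow> {f u, f v} \<in> snd G'"
    and loopless: "\<And>a. {a} \<notin> snd G'"
    and loc_inj: "\<And>u v w. {v, u} \<in> snd G \<Longrightarrow> {v, w} \<in> snd G \<Longrightarrow> f u = f w \<Longrightarrow> u = w"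
  shows "girth G' \<le> girth G"
proof -
  have "\<exists>ws. is_cycle G' ws \<and> length ws \<le> length vs" if cyc: "is_cycle G vs" for vs
  proof -
    define k where "k = length vs"
    \<comment> \<open>The cycle is unrolled to a walk \<open>u\<close> of period \<open>k\<close>,
      indexed by all natural numbers, so that segments can be cut out without wrap-around;
      \<open>v\<close> is its image in \<open>G'\<close>.\<close>
    define u where "u i = vs ! (i mod k)" for i
    define v where "v i = f (u i)" for i
    have k: "3 \<le> k" and "distinct vs" "set vs \<subseteq> fst G"
      and cyc_edge: "\<And>i. i < k \<Longrightarrow> {vs ! i, vs ! (Suc i mod k)} \<in> snd G"
      using cyc by (auto simp: is_cycle_def k_def)
    have u_edge: "{u i, u (Suc i)} \<in> snd G" for i
      using cyc_edge[of "i mod k"] k by (simp add: u_def mod_Suc_eq)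
    have v_edge: "{v i, v (Suc i)} \<in> snd G'" for i
      unfolding v_def by (rule edge[OF u_edge])
    have mod_k: "i mod k < k" for i
      using k by (intro mod_less_divisor) linarith
    have v_vert: "v i \<in> fst G'" for i
    proof -
      have "u i \<in> set vs"
        unfolding u_def using mod_k by (simp add: k_def)
      then show ?thesis
        using vert \<open>set vs \<subseteq> fst G\<close> by (auto simp: v_def)
    qed
    \<comment> \<open>\<open>D d\<close> says that the image walk meets some vertex again after
      \<open>d\<close> steps. Periodicity gives \<open>D k\<close>, so the least such
      \<open>d\<close> is at most \<open>k\<close>; its minimality will make the \<open>d\<close>
      vertices before the return distinct.\<close>
    define D where "D d \<longleftrightarrow> 0 < d \<and> (\<exists>i. v (i + d) = v i)" for d
    define d where "d = (LEAST d. D d)"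
    have "D k"
      using k by (auto simp: D_def v_def u_def)
    then have "D d" and "d \<le> k"
      unfolding d_def by (auto intro: LeastI Least_le)
    have minimal: "\<not> D e" if "e < d" for e
      using that not_less_Least unfolding d_def by blast
    obtain i where i: "v (i + d) = v i" and "0 < d"
      using \<open>D d\<close> by (auto simp: D_def)
    have "d \<noteq> 1"
      using v_edge[of i] loopless[of "v i"] i by auto
    \<comment> \<open>A return after two steps would give \<open>u (i + 1)\<close> two neighbours
      with the same image. Local injectivity identifies them, and as \<open>vs\<close> is distinct,
      \<open>k\<close> would divide 2.\<close>
    moreover have "d \<noteq> 2"
    proof
      assume "d = 2"
      have "u (i + 2) = u i"
      proof (rule loc_inj)
        show "{u (i + 1), u (i + 2)} \<in> snd G" "{u (i + 1), u i} \<in> snd G"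
          using u_edge[of "i + 1"] u_edge[of i] by (simp_all add: insert_commute)
        show "f (u (i + 2)) = f (u i)"
          using i \<open>d = 2\<close> by (simp add: v_def)
      qed
      then have "[i + 2 = i + 0] (mod k)"
        using nth_eq_iff_index_eq[OF \<open>distinct vs\<close>] mod_k unfolding u_def cong_def k_def by auto
      then have "[2 = 0] (mod k)"
        by (simp only: cong_add_lcancel_nat)
      then show False
        using k by (simp add: cong_def)
    qed
    ultimately have d: "3 \<le> d"
      using \<open>0 < d\<close> by linarith
    define ws where "ws = map v [i..<i + d]"
    have no_return: "v a \<noteq> v b" if "i \<le> a" "a < b" "b < i + d" for a b
    proof -
      have "\<not> D (b - a)"
        using that by (intro minimal) linarith
      then have "v (a + (b - a)) \<noteq> v a"
        using that unfolding D_def by (metis zero_less_diff)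
      then show ?thesis
        using that by auto
    qed
    have "inj_on v {i..<i + d}"
      by (rule linorder_inj_onI') (auto dest: no_return)
    moreover have "{ws ! j, ws ! (Suc j mod d)} \<in> snd G'" if "j < d" for j
    \<comment> \<open>The last edge of \<open>ws\<close> leads back to its first vertex because
      \<open>v (i + d) = v i\<close>.\<close>
    proof (cases "Suc j = d")
      case True
      then show ?thesis
        using v_edge[of "i + j"] i \<open>0 < d\<close> by (auto simp: ws_def)
    next
      case False
      then show ?thesis
        using v_edge[of "i + j"] that by (simp add: ws_def)
    qed
    ultimately have "is_cycle G' ws"
      using d v_vert by (auto simp: is_cycle_def ws_def distinct_map)
    then show ?thesis
      using \<open>d \<le> k\<close> by (auto simp: ws_def k_def)
  qed
  then show ?thesis
    unfolding girth_def by (intro INF_mono) auto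
qed

lemma tanner_graph_edge_iff:
  "e \<in> snd (tanner_graph H) \<longleftrightarrow>
     (\<exists>r c. e = {Inl r, Inr c} \<and> r < dim_row H \<and> c < dim_col H \<and> H $$ (r, c) = 1)"
  by (auto simp: tanner_graph_def)

lemma min_distance_antimono: "C \<subseteq> D \<Longrightarrow> min_distance D \<le> min_distance C"
  unfolding min_distance_def by (rule INF_superset_mono) auto

section \<open>Entries of circulant blocks and of the parity-check matrix\<close>

lemma block_carrier [simp]: "block N v \<in> carrier_mat N N"
  unfolding block_def by (induction v) (auto simp: cpm_def)

text \<open>The sum is taken in \<open>bit\<close>, so it is a parity. This additive form is the one
  that splits along the parts of a dispersion.\<close>

lemma block_index:
  assumes "distinct v" "a < N" "b < N"
  shows "block N v $$ (a, b) = (\<Sum>p\<in>set v. if [b = a + p] (mod N) then 1 else 0)"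
  using assms(1)
proof (induction v)
  case Nil
  then show ?case
    using assms by (simp add: block_def)
next
  case (Cons p v)
  have "block N (p # v) = cpm N p + block N v"
    by (simp add: block_def)
  then show ?case
    using Cons assms carrier_matD[OF block_carrier[of N v]] by (simp add: cpm_def)
qed

text \<open>Exponents are reduced residues, so two that solve the same congruence are equal. Thus at
  most one CPM of a block has a 1 at a given position.\<close>

lemma valid_entry_exponent_unique:
  assumes "valid_entry N v" "p \<in> set v" "q \<in> set v" "[b = a + p] (mod N)" "[b = a + q] (mod N)"
  shows "p = q"
proof -
  have "[p = q] (mod N)"
    using assms(4,5) by (metis cong_add_lcancel_nat cong_sym cong_trans)
  moreover have "p < N" "q < N"
    using assms by (auto simp: valid_entry_def)
  ultimately show ?thesis
    by (simp add: cong_def)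
qed

text \<open>Ones could cancel modulo 2, but at most one summand is nonzero.\<close>

lemma block_index_eq_1_iff:
  assumes "valid_entry N v" "a < N" "b < N"
  shows "block N v $$ (a, b) = 1 \<longleftrightarrow> (\<exists>p\<in>set v. [b = a + p] (mod N))"
proof -
  have eq: "block N v $$ (a, b) = (\<Sum>p\<in>set v. if [b = a + p] (mod N) then 1 else 0)"
    using assms by (intro block_index) (auto simp: valid_entry_def)
  show ?thesis
  proof (cases "\<exists>p\<in>set v. [b = a + p] (mod N)")
    case True
    then obtain p where p: "p \<in> set v" "[b = a + p] (mod N)"
      by blast
    have "(\<Sum>q\<in>set v. if [b = a + q] (mod N) then 1 else 0 :: bit) =
          (\<Sum>q\<in>set v. if q = p then 1 else 0)"
      using valid_entry_exponent_unique[OF assms(1)] p by (intro sum.cong) auto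
    then show ?thesis
      using eq p by auto
  next
    case False
    then show ?thesis
      using eq by simp
  qed
qed

lemma dim_parity_check [simp]:
  "dim_row (parity_check N P) = dim_row P * N" "dim_col (parity_check N P) = dim_col P * N"
  by (simp_all add: parity_check_def)

lemma parity_check_index:
  assumes "r < dim_row P * N" "c < dim_col P * N"
  shows "parity_check N P $$ (r, c) = block N (P $$ (r div N, c div N)) $$ (r mod N, c mod N)"
  using assms by (simp add: parity_check_def)

lemma parity_check_index_eq_1_iff:
  assumes "exponent_matrix N m n P" "r < m * N" "c < n * N"
  shows "parity_check N P $$ (r, c) = 1 \<longleftrightarrow>
    (\<exists>p\<in>set (P $$ (r div N, c div N)). [c = r mod N + p] (mod N))"
proof -
  have "r div N < m" "c div N < n" "0 < N" "dim_row P = m" "dim_col P = n"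
    using assms by (auto simp: exponent_matrix_def less_mult_imp_div_less)
  then show ?thesis
    using assms by (subst parity_check_index)
      (auto simp: block_index_eq_1_iff exponent_matrix_def cong_def)
qed

section \<open>Dispersion of a single entry\<close>

lemma column_dispersion_length_le:
  assumes "column_dispersion m v w" "i < m"
  shows "length (w $ i) \<le> length v"
proof -
  have "length (w $ i) = card (set (w $ i))"
    using assms by (simp add: column_dispersion_def distinct_card)
  also have "\<dots> \<le> card (set v)"
    using assms by (intro card_mono) (auto simp: column_dispersion_def)
  also have "\<dots> \<le> length v"
    by (rule card_length)
  finally show ?thesis .
qed

text \<open>The set of exponents is the disjoint union of the parts, so the sum over it splits into
  one sum for each part.\<close>

lemma block_column_dispersion:
  assumes disp: "column_dispersion m v w" and "distinct v" "a < N" "b < N"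
  shows "block N v $$ (a, b) = (\<Sum>i<m. block N (w $ i) $$ (a, b))"
proof -
  let ?g = "\<lambda>p. if [b = a + p] (mod N) then 1 else 0 :: bit"
  have parts: "set v = (\<Union>i<m. set (w $ i))"
    using disp by (auto simp: column_dispersion_def; blast)
  have "block N v $$ (a, b) = sum ?g (\<Union>i<m. set (w $ i))"
    using assms by (simp add: block_index flip: parts)
  also have "\<dots> = (\<Sum>i<m. sum ?g (set (w $ i)))"
    using disp by (intro sum.UNION_disjoint) (auto simp: column_dispersion_def; blast)+
  also have "\<dots> = (\<Sum>i<m. block N (w $ i) $$ (a, b))"
    using assms by (intro sum.cong refl block_index[symmetric]) (auto simp: column_dispersion_def)
  finally show ?thesis .
qed

section \<open>The dispersed matrix \<open>Q\<close> and its type\<close>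

locale dispersed_matrix =
  fixes m n N :: nat and P Q :: "exp_entry mat"
  assumes m_pos: "0 < m"
    and P: "exponent_matrix N 1 n P"
    and Q_carrier: "Q \<in> carrier_mat m n"
    and disp: "\<And>j. j < n \<Longrightarrow> column_dispersion m (P $$ (0, j)) (col Q j)"
begin

lemma N_pos: "0 < N" and P_carrier: "P \<in> carrier_mat 1 n"
  and P_valid: "j < n \<Longrightarrow> valid_entry N (P $$ (0, j))"
  using P by (auto simp: exponent_matrix_def)

lemma col_Q [simp]: "i < m \<Longrightarrow> j < n \<Longrightarrow> col Q j $ i = Q $$ (i, j)"
  using Q_carrier by simp

lemma Q_subset: "i < m \<Longrightarrow> j < n \<Longrightarrow> set (Q $$ (i, j)) \<subseteq> set (P $$ (0, j))"
  and Q_distinct: "i < m \<Longrightarrow> j < n \<Longrightarrow> distinct (Q $$ (i, j))"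
  and Q_cover: "j < n \<Longrightarrow> p \<in> set (P $$ (0, j)) \<Longrightarrow> \<exists>i<m. p \<in> set (Q $$ (i, j))"
  and Q_unique: "i < m \<Longrightarrow> i' < m \<Longrightarrow> j < n \<Longrightarrow>
    p \<in> set (Q $$ (i, j)) \<Longrightarrow> p \<in> set (Q $$ (i', j)) \<Longrightarrow> i = i'"
  using disp[of j] col_Q[of _ j] unfolding column_dispersion_def by (metis subsetD)+

lemma Q_exponent_matrix: "exponent_matrix N m n Q"
  using P m_pos Q_carrier Q_subset Q_distinct unfolding exponent_matrix_def valid_entry_def
  by (metis less_one subset_trans)

text \<open>The witness is the greatest length of a part. No part is longer than the entry it comes
  from; and since \<open>L\<close> is at least 1, some entry of \<open>P\<close> has an exponent,
  which lies in some part.\<close>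

lemma Q_type:
  assumes "type_exponent_matrix N 1 n L P"
  shows "\<exists>L'\<ge>1. L' \<le> L \<and> type_exponent_matrix N m n L' Q"
proof -
  let ?SP = "{length (P $$ (i, j)) | i j. i < (1::nat) \<and> j < n}"
  let ?SQ = "{length (Q $$ (i, j)) | i j. i < m \<and> j < n}"
  have L: "1 \<le> L" "L = Max ?SP"
    using assms by (auto simp: type_exponent_matrix_def)
  have "0 < n"
    using P by (simp add: exponent_matrix_def)
  have fin: "finite ?SP" "finite ?SQ"
    by (rule finite_image_set2; simp)+
  have ne: "?SP \<noteq> {}" "?SQ \<noteq> {}"
    using \<open>0 < n\<close> m_pos by auto
  have "Max ?SQ \<le> L"
  proof -
    have "x \<le> L" if x: "x \<in> ?SQ" for x
    proof -
      obtain i j where ij: "x = length (Q $$ (i, j))" "i < m" "j < n"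
        using x by auto
      then have "x \<le> length (P $$ (0, j))"
        using column_dispersion_length_le[OF disp] by (metis col_Q)
      also have "\<dots> \<le> L"
        unfolding L(2) using fin ij by (intro Max_ge) auto
      finally show ?thesis .
    qed
    then show ?thesis
      using fin ne by simp
  qed
  moreover have "1 \<le> Max ?SQ"
  proof -
    have "L \<in> ?SP"
      unfolding L(2) using fin ne by (intro Max_in)
    then obtain j where j: "j < n" "L = length (P $$ (0, j))"
      by auto
    then obtain p where "p \<in> set (P $$ (0, j))"
      using L(1) by (cases "P $$ (0, j)") auto
    then obtain i where i: "i < m" "p \<in> set (Q $$ (i, j))"
      using Q_cover j by blast
    then have "1 \<le> length (Q $$ (i, j))"
      by (cases "Q $$ (i, j)") auto
    also have "\<dots> \<le> Max ?SQ"
      using fin i j by (intro Max_ge) auto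
    finally show ?thesis .
  qed
  ultimately show ?thesis
    using Q_exponent_matrix by (auto simp: type_exponent_matrix_def)
qed

section \<open>Inclusion of codes\<close>

text \<open>The rows \<open>i * N + a\<close> are those with offset \<open>a\<close> in their block
  row. \<open>P\<close> has only block row 0, so \<open>a\<close> is itself a row index of its
  parity-check matrix.\<close>

lemma parity_check_sum_rows:
  assumes "a < N" "c < n * N"
  shows "parity_check N P $$ (a, c) = (\<Sum>i<m. parity_check N Q $$ (i * N + a, c))"
proof -
  have c: "c div N < n" "c mod N < N"
    using assms N_pos by (auto simp: less_mult_imp_div_less)
  have row: "i * N + a < m * N" if "i < m" for i
  proof -
    have "i * N + a < Suc i * N"
      using assms by simp
    also have "\<dots> \<le> m * N"
      using that by (intro mult_le_mono1) simp
    finally show ?thesis .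
  qed
  have "parity_check N P $$ (a, c) = block N (P $$ (0, c div N)) $$ (a, c mod N)"
    using assms P_carrier by (simp add: parity_check_index)
  also have "\<dots> = (\<Sum>i<m. block N (col Q (c div N) $ i) $$ (a, c mod N))"
    using disp P_valid assms c by (intro block_column_dispersion) (auto simp: valid_entry_def)
  also have "\<dots> = (\<Sum>i<m. parity_check N Q $$ (i * N + a, c))"
    using assms c row Q_carrier by (intro sum.cong) (auto simp: parity_check_index)
  finally show ?thesis .
qed

lemma code_subset: "code N Q \<subseteq> code N P"
proof
  fix x assume x: "x \<in> code N Q"
  let ?H = "parity_check N P" and ?H' = "parity_check N Q"
  have dims: "dim_col P = n" "dim_row P = 1" "dim_col Q = n" "dim_row Q = m"
    using P_carrier Q_carrier by auto
  have dx: "dim_vec x = n * N" and ker: "?H' *\<^sub>v x = 0\<^sub>v (m * N)"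
    using x dims by (auto simp: code_def mat_kernel_def)
  have zero: "(?H *\<^sub>v x) $ a = 0" if a: "a < N" for a
  proof -
    have "(?H *\<^sub>v x) $ a = (\<Sum>c = 0..<n * N. ?H $$ (a, c) * x $ c)"
      using a dx dims by (simp add: scalar_prod_def)
    also have "\<dots> = (\<Sum>c = 0..<n * N. \<Sum>i<m. ?H' $$ (i * N + a, c) * x $ c)"
      using a by (intro sum.cong refl)
        (simp only: parity_check_sum_rows sum_distrib_right atLeastLessThan_iff)
    \<comment> \<open>After the exchange each inner sum is a component of
      \<open>?H' *\<^sub>v x\<close>, hence zero.\<close>
    also have "\<dots> = (\<Sum>i<m. \<Sum>c = 0..<n * N. ?H' $$ (i * N + a, c) * x $ c)"
      by (rule sum.swap)
    also have "\<dots> = (\<Sum>i<m. 0)"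
    proof (rule sum.cong)
      fix i assume "i \<in> {..<m}"
      then have "Suc i * N \<le> m * N"
        by (intro mult_le_mono1) simp
      then have r: "i * N + a < m * N"
        using a by simp
      then have "(\<Sum>c = 0..<n * N. ?H' $$ (i * N + a, c) * x $ c) = (?H' *\<^sub>v x) $ (i * N + a)"
        using dx dims by (simp add: scalar_prod_def)
      then show "(\<Sum>c = 0..<n * N. ?H' $$ (i * N + a, c) * x $ c) = 0"
        using ker r by simp
    qed simp
    finally show ?thesis by simp
  qed
  have "?H *\<^sub>v x = 0\<^sub>v N"
  proof (rule eq_vecI)
    fix a assume "a < dim_vec (0\<^sub>v N :: bit vec)"
    then have "a < N"
      by simp
    then show "(?H *\<^sub>v x) $ a = 0\<^sub>v N $ a"
      by (simp only: zero index_zero_vec)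
  qed (simp add: dims)
  then show "x \<in> code N P"
    using carrier_vecI[OF dx] unfolding code_def mat_kernel_def by (simp only: mem_Collect_eq
        dim_parity_check dims mult_1)
qed

section \<open>Merging rows in the Tanner graph\<close>

text \<open>Passing to \<open>r mod N\<close> keeps the offset inside the block, and every part is
  contained in the entry of \<open>P\<close>. This makes merging a homomorphism.\<close>

lemma parity_check_merge_row:
  assumes "r < m * N" "c < n * N" "parity_check N Q $$ (r, c) = 1"
  shows "parity_check N P $$ (r mod N, c) = 1"
proof -
  have "r div N < m" "c div N < n"
    using assms by (auto simp: less_mult_imp_div_less)
  then show ?thesis
    using assms Q_subset N_pos parity_check_index_eq_1_iff[OF Q_exponent_matrix, of r c]
      parity_check_index_eq_1_iff[OF P, of "r mod N" c] by auto
qed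

text \<open>Local injectivity at a column vertex: the common offset and \<open>c\<close> determine
  the exponent, and that exponent lies in only one part, which fixes the block row.\<close>

lemma parity_check_merge_row_inj:
  assumes "r < m * N" "r' < m * N" "c < n * N" "r mod N = r' mod N"
    and "parity_check N Q $$ (r, c) = 1" "parity_check N Q $$ (r', c) = 1"
  shows "r = r'"
proof -
  have idx: "r div N < m" "r' div N < m" "c div N < n"
    using assms by (auto simp: less_mult_imp_div_less)
  obtain p where p: "p \<in> set (Q $$ (r div N, c div N))" "[c = r mod N + p] (mod N)"
    using assms parity_check_index_eq_1_iff[OF Q_exponent_matrix] by blast
  obtain q where q: "q \<in> set (Q $$ (r' div N, c div N))" "[c = r mod N + q] (mod N)"
    using assms parity_check_index_eq_1_iff[OF Q_exponent_matrix] by metis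
  have "p = q"
    using valid_entry_exponent_unique[OF P_valid[OF idx(3)]] Q_subset idx p q by blast
  then have "r div N = r' div N"
    using Q_unique idx p q by blast
  then show ?thesis
    using assms(4) by (metis div_mult_mod_eq)
qed

lemma girth_le:
  "girth (tanner_graph (parity_check N P)) \<le> girth (tanner_graph (parity_check N Q))"
proof (rule girth_le_of_locally_injective_hom)
  let ?f = "map_sum (\<lambda>r. r mod N) (\<lambda>c. c) :: nat + nat \<Rightarrow> nat + nat"
  \<comment> \<open>The homomorphism runs from \<open>?G'\<close>, the graph of \<open>Q\<close>, to
    \<open>?G\<close>, so the prime marks the source here and not the target.\<close>
  let ?G = "tanner_graph (parity_check N P)" and ?G' = "tanner_graph (parity_check N Q)"
  have dims: "dim_col P = n" "dim_row P = 1" "dim_col Q = n" "dim_row Q = m"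
    using P_carrier Q_carrier by auto
  have edge: "e \<in> snd ?G' \<longleftrightarrow> (\<exists>r c. e = {Inl r, Inr c} \<and> r < m * N \<and> c < n * N \<and>
      parity_check N Q $$ (r, c) = 1)" for e
    by (simp add: tanner_graph_edge_iff dims)
  show "?f ` fst ?G' \<subseteq> fst ?G"
    using dims N_pos by (auto simp: tanner_graph_def)
  show "{a} \<notin> snd ?G" for a
    by (auto simp: tanner_graph_edge_iff)
  show "{?f u, ?f v} \<in> snd ?G" if uv: "{u, v} \<in> snd ?G'" for u v
  proof -
    obtain r c where rc: "{u, v} = {Inl r, Inr c}" "r < m * N" "c < n * N"
        "parity_check N Q $$ (r, c) = 1"
      using uv unfolding edge by blast
    have "{?f u, ?f v} = {Inl (r mod N), Inr c}"
      using rc(1) by (auto simp: doubleton_eq_iff)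
    then show ?thesis
      using parity_check_merge_row[OF rc(2-4)] rc N_pos dims
      by (auto simp: tanner_graph_edge_iff)
  qed
  show "u = w" if vu: "{v, u} \<in> snd ?G'" and vw: "{v, w} \<in> snd ?G'" and fuw: "?f u = ?f w"
    for u v w
  proof -
    obtain r c where rc: "{v, u} = {Inl r, Inr c}" "r < m * N" "c < n * N"
        "parity_check N Q $$ (r, c) = 1"
      using vu unfolding edge by blast
    obtain r' c' where rc': "{v, w} = {Inl r', Inr c'}" "r' < m * N" "c' < n * N"
        "parity_check N Q $$ (r', c') = 1"
      using vw unfolding edge by blast
    \<comment> \<open>The graph is bipartite: either \<open>v\<close> is a row and its neighbours
      are columns, which \<open>?f\<close> fixes, or \<open>v\<close> is a column and its neighbours
      are rows, where merging is injective.\<close>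
    consider "u = Inr c" "w = Inr c'" | "v = Inr c" "u = Inl r" "c' = c" "w = Inl r'"
      using rc(1) rc'(1) by (auto simp: doubleton_eq_iff)
    then show ?thesis
    proof cases
      case 1
      then show ?thesis
        using fuw by simp
    next
      case 2
      then have "r = r'"
        using parity_check_merge_row_inj[OF rc(2) rc'(2) rc(3)] fuw rc(4) rc'(4) by simp
      then show ?thesis
        using 2 by simp
    qed
  qed
qed

end

theorem proposition1:
  fixes L m n N :: nat and P Pstar :: "exp_entry mat"
  assumes "0 < L" and "1 < m" and "0 < n" and "0 < N"
    and "type_exponent_matrix N 1 n L P"
    and "Pstar \<in> carrier_mat m n"
    and "\<forall>j<n. column_dispersion m (P $$ (0, j)) (col Pstar j)"
  shows "(\<exists>Lstar. 1 \<le> Lstar \<and> Lstar \<le> L \<and> type_exponent_matrix N m n Lstar Pstar)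
    \<and> girth (tanner_graph (parity_check N Pstar)) \<ge> girth (tanner_graph (parity_check N P))
    \<and> min_distance (code N Pstar) \<ge> min_distance (code N P)"
proof -
  interpret dispersed_matrix m n N P Pstar
    using assms by unfold_locales (auto simp: type_exponent_matrix_def)
  show ?thesis
    using Q_type[OF assms(5)] girth_le min_distance_antimono[OF code_subset] by blast
qed

end
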